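(* Let $S=K[x_1,\ldots,x_n]$ be a polynomial ring over a field $K$, let $v\in S$ be a squarefree monomial of degree $2$, and let $I=(L^i(v))\subset S$ be the initial lexsegment edge ideal determined by $v$. For $t\geq 1$, write $G(I^t)=\{u_1,\ldots,u_m\}$ with $u_1>_{lex}\cdots>_{lex}u_m$. Then for all $2\leq i\leq m$, $$(u_1,\ldots,u_{i-1}):(u_i)=\bigl(x_r \;:\; 1\leq r\leq \max(u_i)-1,\ \nu_r(x_ru_i)\leq t\bigr).$$
   Context: Monomials of $S$ are ordered lexicographically with $x_1>_{lex}\cdots>_{lex}x_n$. For a squarefree monomial $v$ of degree $2$, $L^i(v)=\{w : w \text{ is a squarefree monomial of degree } 2 \text{ in } S,\ w\geq_{lex}v\}$; the ideal generated by $L^i(v)$ is called an initial lexsegment edge ideal. For a monomial ideal $J$, $G(J)$ denotes its set of minimal monomial generators. For a monomial $u$, $\operatorname{supp}(u)=\{i: x_i\mid u\}$, $\max(u)=\max(\operatorname{supp}(u))$, and $\nu_s(u)$ is the exponent of $x_s$ in $u$. *)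

theory Defs
  imports "HOL-Library.Poly_Mapping" "HOL-Algebra.Ideal_Product"
begin

text \<open>
  A monomial in \<open>x\<^sub>1, \<dots>, x\<^sub>n\<close> is represented by its exponent vector, a finitely supported
  map \<^typ>\<open>nat \<Rightarrow>\<^sub>0 nat\<close> whose support lies in \<open>{1..n}\<close>.  Hence \<^term>\<open>Poly_Mapping.keys u\<close> is \<open>supp(u)\<close>,
  \<^term>\<open>Poly_Mapping.lookup u s\<close> is the exponent \<open>\<nu>\<^sub>s(u)\<close>, and \<^term>\<open>u + w\<close> is the product of monomials.
  Polynomials over \<open>'k\<close> are finitely supported maps from monomials to \<open>'k\<close>, with the
  convolution product of \<^theory>\<open>HOL-Library.Poly_Mapping\<close>.
\<close>

type_synonym monom = "nat \<Rightarrow>\<^sub>0 nat"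
type_synonym 'k mpoly = "monom \<Rightarrow>\<^sub>0 'k"

definition monomials :: "nat \<Rightarrow> monom set" where
  "monomials n = {u. Poly_Mapping.keys u \<subseteq> {1..n}}"

definition monom_poly :: "monom \<Rightarrow> 'k::field mpoly" where
  "monom_poly u = Poly_Mapping.single u 1"

definition var :: "nat \<Rightarrow> monom" where
  "var r = Poly_Mapping.single r 1"

definition poly_ring :: "nat \<Rightarrow> 'k::field mpoly ring" where
  "poly_ring n = \<lparr>carrier = {p. Poly_Mapping.keys p \<subseteq> monomials n}, mult = (*), one = 1, zero = 0, add = (+)\<rparr>"

definition monom_degree :: "monom \<Rightarrow> nat" where
  "monom_degree u = (\<Sum>s\<in>Poly_Mapping.keys u. Poly_Mapping.lookup u s)"

definition squarefree_monom :: "monom \<Rightarrow> bool" where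
  "squarefree_monom u \<longleftrightarrow> (\<forall>s. Poly_Mapping.lookup u s \<le> 1)"

definition monom_dvd :: "monom \<Rightarrow> monom \<Rightarrow> bool" where
  "monom_dvd u w \<longleftrightarrow> (\<exists>z. w = u + z)"

text \<open>
  The library order on \<^typ>\<open>nat \<Rightarrow>\<^sub>0 nat\<close> is the lexicographic order with
  \<open>x\<^sub>1 > x\<^sub>2 > \<cdots>\<close>: the exponent vectors are compared at the smallest index where they differ.
  In particular \<open>\<le>\<close> on monomials is not divisibility.
\<close>

lemma monom_less_iff_lex:
  fixes u w :: monom
  shows "u < w \<longleftrightarrow> (\<exists>k. Poly_Mapping.lookup u k < Poly_Mapping.lookup w k \<and> (\<forall>j<k. Poly_Mapping.lookup u j = Poly_Mapping.lookup w j))"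
  by (simp add: less_poly_mapping.rep_eq less_fun_def)

lemma var_less_var_iff: "var r < var s \<longleftrightarrow> s < r"
  unfolding monom_less_iff_lex var_def lookup_single
  by (auto simp: when_def not_less_iff_gr_or_eq split: if_splits)

definition lex_initial :: "nat \<Rightarrow> monom \<Rightarrow> monom set" where
  "lex_initial n v =
     {w \<in> monomials n. squarefree_monom w \<and> monom_degree w = 2 \<and> v \<le> w}"

definition min_mon_gens :: "nat \<Rightarrow> 'k::field mpoly set \<Rightarrow> monom set" where
  "min_mon_gens n J =
     {u \<in> monomials n. monom_poly u \<in> J \<and>
        (\<forall>w\<in>monomials n. monom_poly w \<in> J \<and> monom_dvd w u \<longrightarrow> w = u)}"

definition colon_ideal :: "('a, 'b) ring_scheme \<Rightarrow> 'a set \<Rightarrow> 'a set \<Rightarrow> 'a set" where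
  "colon_ideal R I J = {f \<in> carrier R. \<forall>g\<in>J. f \<otimes>\<^bsub>R\<^esub> g \<in> I}"

lemma monomials_add_iff: "u + w \<in> monomials n \<longleftrightarrow> u \<in> monomials n \<and> w \<in> monomials n"
proof -
  have "Poly_Mapping.keys (u + w) = Poly_Mapping.keys u \<union> Poly_Mapping.keys w"
    by (auto simp: in_keys_iff lookup_add)
  then show ?thesis by (auto simp: monomials_def)
qed

lemma mult_carrier:
  assumes "Poly_Mapping.keys p \<subseteq> monomials n" "Poly_Mapping.keys q \<subseteq> monomials n"
  shows "Poly_Mapping.keys (p * q) \<subseteq> monomials n"
  using assms keys_mult[of p q] by (fastforce simp: monomials_add_iff)

lemma cring_poly_ring: "cring (poly_ring n :: 'k::field mpoly ring)"
proof (rule cringI)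
  have neg: "\<exists>q. Poly_Mapping.keys q \<subseteq> monomials n \<and> p + q = 0"
    if "Poly_Mapping.keys p \<subseteq> monomials n" for p :: "'k mpoly"
    by (rule exI[of _ "- p"]) (use that in simp)
  have one_closed: "0 \<in> monomials n"
    by (simp add: monomials_def)
  have "Poly_Mapping.keys (p + q) \<subseteq> monomials n" if "Poly_Mapping.keys p \<subseteq> monomials n" "Poly_Mapping.keys q \<subseteq> monomials n"
    for p q :: "'k mpoly"
    using that keys_add[of p q] by blast
  then show "abelian_group (poly_ring n :: 'k mpoly ring)"
    by (intro abelian_groupI) (auto simp: poly_ring_def add_ac intro!: neg)
  show "comm_monoid (poly_ring n :: 'k mpoly ring)"
    by (rule comm_monoidI)
      (auto simp: poly_ring_def mult_ac one_closed dest: subsetD[OF mult_carrier])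
qed (simp add: poly_ring_def algebra_simps)

lemma monom_poly_carrier_iff [simp]: "monom_poly u \<in> carrier (poly_ring n) \<longleftrightarrow> u \<in> monomials n"
  by (simp add: monom_poly_def poly_ring_def)

text \<open>
  \<^const>\<open>min_mon_gens\<close> is indeed the set of minimal monomial generators: any set of
  monomials that generates \<open>J\<close> irredundantly coincides with it.
\<close>

lemma monom_poly_in_genideal_iff:
  assumes A: "A \<subseteq> monomials n" and u: "u \<in> monomials n"
  shows "(monom_poly u :: 'k::field mpoly) \<in> Idl\<^bsub>poly_ring n\<^esub> (monom_poly ` A)
           \<longleftrightarrow> (\<exists>w\<in>A. monom_dvd w u)"
proof
  let ?R = "poly_ring n :: 'k mpoly ring"
  interpret R: cring ?R by (rule cring_poly_ring)
  let ?M = "{p :: 'k mpoly. Poly_Mapping.keys p \<subseteq> {z \<in> monomials n. \<exists>w\<in>A. monom_dvd w z}}"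
  have idl: "ideal ?M ?R"
  proof (rule idealI)
    show "ring ?R" ..
    show "subgroup ?M (add_monoid ?R)"
    proof (rule R.add.subgroupI)
      show "?M \<subseteq> carrier ?R" by (auto simp: poly_ring_def)
      have "0 \<in> ?M" by simp
      then show "?M \<noteq> {}" by blast
      fix p assume p: "p \<in> ?M"
      have "\<ominus>\<^bsub>?R\<^esub> p = - p"
        by (rule R.minus_equality) (use p in \<open>auto simp: poly_ring_def\<close>)
      then show "\<ominus>\<^bsub>?R\<^esub> p \<in> ?M" using p by simp
      fix q assume "q \<in> ?M"
      then show "p \<oplus>\<^bsub>?R\<^esub> q \<in> ?M"
        using p keys_add[of p q] by (auto simp: poly_ring_def)
    qed
    fix p q :: "'k mpoly"
    assume p: "p \<in> ?M" and q: "q \<in> carrier ?R"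
    have "z \<in> monomials n \<and> (\<exists>w\<in>A. monom_dvd w z)" if "z \<in> Poly_Mapping.keys (p * q)" for z
    proof -
      obtain a b where ab: "z = a + b" "a \<in> Poly_Mapping.keys p" "b \<in> Poly_Mapping.keys q"
        using \<open>z \<in> Poly_Mapping.keys (p * q)\<close> keys_mult[of p q] by blast
      obtain w c where "w \<in> A" "a = w + c" "a \<in> monomials n"
        using ab(2) p unfolding monom_dvd_def by blast
      then show ?thesis
        using ab q by (auto simp: monomials_add_iff monom_dvd_def poly_ring_def add.assoc)
    qed
    then show "p \<otimes>\<^bsub>?R\<^esub> q \<in> ?M" by (auto simp: poly_ring_def)
    then show "q \<otimes>\<^bsub>?R\<^esub> p \<in> ?M" by (simp add: poly_ring_def mult.commute)
  qed
  have "monom_poly ` A \<subseteq> ?M"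
    using A by (force simp: monom_poly_def monom_dvd_def)
  then have "Idl\<^bsub>?R\<^esub> (monom_poly ` A) \<subseteq> ?M"
    by (rule R.genideal_minimal[OF idl])
  moreover assume "(monom_poly u :: 'k mpoly) \<in> Idl\<^bsub>?R\<^esub> (monom_poly ` A)"
  ultimately show "\<exists>w\<in>A. monom_dvd w u" by (auto simp: monom_poly_def)
next
  let ?R = "poly_ring n :: 'k mpoly ring"
  interpret R: cring ?R by (rule cring_poly_ring)
  have sub: "monom_poly ` A \<subseteq> carrier ?R" using A by auto
  assume "\<exists>w\<in>A. monom_dvd w u"
  then obtain w z where w: "w \<in> A" and z: "u = w + z" by (auto simp: monom_dvd_def)
  have "monom_poly w \<in> Idl\<^bsub>?R\<^esub> (monom_poly ` A)"
    using R.genideal_self[OF sub] w by blast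
  moreover have "monom_poly z \<in> carrier ?R" using u z by (simp add: monomials_add_iff)
  ultimately have "monom_poly w \<otimes>\<^bsub>?R\<^esub> monom_poly z \<in> Idl\<^bsub>?R\<^esub> (monom_poly ` A)"
    by (rule ideal.I_r_closed[OF R.genideal_ideal[OF sub]])
  then show "(monom_poly u :: 'k mpoly) \<in> Idl\<^bsub>?R\<^esub> (monom_poly ` A)"
    by (simp add: z monom_poly_def poly_ring_def mult_single)
qed

lemma min_mon_gens_eqI:
  fixes J :: "'k::field mpoly set"
  assumes A: "A \<subseteq> monomials n" and gen: "Idl\<^bsub>poly_ring n\<^esub> (monom_poly ` A) = J"
    and irr: "\<And>B. B \<subset> A \<Longrightarrow> Idl\<^bsub>poly_ring n\<^esub> (monom_poly ` B) \<noteq> J"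
  shows "A = min_mon_gens n J"
proof -
  let ?R = "poly_ring n :: 'k mpoly ring"
  interpret R: cring ?R by (rule cring_poly_ring)
  have inJ: "monom_poly u \<in> J \<longleftrightarrow> (\<exists>w\<in>A. monom_dvd w u)" if "u \<in> monomials n" for u
    using monom_poly_in_genideal_iff[OF A that, where 'k = 'k] gen by simp
  have dvd_refl: "monom_dvd u u" for u
    unfolding monom_dvd_def by (rule exI[of _ 0]) simp
  have dvd_trans: "monom_dvd u z" if "monom_dvd u w" "monom_dvd w z" for u w z
    using that by (auto simp: monom_dvd_def add.assoc)
  have dvd_antisym: "u = w" if "monom_dvd u w" "monom_dvd w u" for u w
  proof -
    from that obtain a b where "w = u + a" "u = w + b" by (auto simp: monom_dvd_def)
    then have "\<And>s. Poly_Mapping.lookup u s = Poly_Mapping.lookup w s"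
      by (metis add_leE lookup_add le_antisym order_refl)
    then show ?thesis by (rule poly_mapping_eqI)
  qed
  have anti: "a = b" if a: "a \<in> A" and b: "b \<in> A" and ab: "monom_dvd a b" for a b
  proof (rule ccontr)
    assume ne: "a \<noteq> b"
    let ?B = "A - {b}"
    have B: "?B \<subseteq> monomials n" using A by blast
    have carB: "monom_poly ` ?B \<subseteq> carrier ?R" and carA: "monom_poly ` A \<subseteq> carrier ?R" using A by auto
    have "monom_poly c \<in> Idl\<^bsub>?R\<^esub> (monom_poly ` ?B)" if "c \<in> A" for c
      unfolding monom_poly_in_genideal_iff[OF B subsetD[OF A that]]
      using that a ab ne dvd_refl by (cases "c = b") blast+
    then have "Idl\<^bsub>?R\<^esub> (monom_poly ` A) \<subseteq> Idl\<^bsub>?R\<^esub> (monom_poly ` ?B)"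
      by (intro R.genideal_minimal R.genideal_ideal carB) blast
    moreover have "Idl\<^bsub>?R\<^esub> (monom_poly ` ?B) \<subseteq> Idl\<^bsub>?R\<^esub> (monom_poly ` A)"
      by (intro R.genideal_minimal R.genideal_ideal carA order_trans[OF _ R.genideal_self[OF carA]])
        blast
    ultimately show False using irr[of ?B] b gen by blast
  qed
  show ?thesis
  proof (intro equalityI subsetI)
    fix u assume u: "u \<in> A"
    have "w = u" if "w \<in> monomials n" "monom_poly w \<in> J" "monom_dvd w u" for w
      using inJ[OF that(1)] that u anti dvd_trans dvd_antisym by metis
    then show "u \<in> min_mon_gens n J"
      using u A inJ[of u] dvd_refl by (auto simp: min_mon_gens_def)
  next
    fix u assume u: "u \<in> min_mon_gens n J"
    then obtain w where "w \<in> A" "monom_dvd w u"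
      using inJ[of u] by (auto simp: min_mon_gens_def)
    moreover from this have "w = u"
      using u A inJ[of w] dvd_refl by (auto simp: min_mon_gens_def)
    ultimately show "u \<in> A" by simp
  qed
qed

end

theory Submission
  imports Defs "HOL-Library.Multiset"
begin

text \<open>
  Every ideal involved is a monomial ideal, so the claim concerns divisibility of monomials:
  writing \<open>u = u\<^sub>i\<close>, some lexicographically greater generator \<open>u'\<close> divides \<open>z u\<close> iff some admissible \<open>x\<^sub>r\<close> divides
  \<open>z\<close>.  Given \<open>u'\<close>, take for \<open>r\<close> the first index where \<open>u'\<close> and \<open>u\<close> differ; since the degrees are
  equal, \<open>r < max(u)\<close>.  Conversely, \<open>x\<^sub>r u / x\<^sub>s\<close> with \<open>s = max(u)\<close> is again a product of \<open>t\<close> edges: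
  either \<open>s\<close> has a neighbour \<open>a \<noteq> r\<close> in a factorization of \<open>u\<close>, and the edge \<open>as\<close> becomes \<open>ar\<close>, or all
  edges at \<open>s\<close> are \<open>rs\<close>; then \<open>\<nu>\<^sub>r(u) < t\<close> gives an edge \<open>bc\<close> avoiding \<open>r\<close> and \<open>s\<close>, and the pair
  \<open>rs\<close>, \<open>bc\<close> becomes \<open>rb\<close>, \<open>rc\<close>.
\<close>

section \<open>Monomial ideals\<close>

lemma monom_dvd_refl: "monom_dvd u u"
  unfolding monom_dvd_def by (rule exI[of _ 0]) simp

lemma monom_dvd_trans: "monom_dvd u w \<Longrightarrow> monom_dvd w z \<Longrightarrow> monom_dvd u z"
  by (auto simp: monom_dvd_def add.assoc)

lemma monom_dvd_iff_lookup:
  "monom_dvd u w \<longleftrightarrow> (\<forall>s. Poly_Mapping.lookup u s \<le> Poly_Mapping.lookup w s)"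
proof
  assume le: "\<forall>s. Poly_Mapping.lookup u s \<le> Poly_Mapping.lookup w s"
  have "w = u + (w - u)"
    by (rule poly_mapping_eqI) (simp add: lookup_add lookup_minus le)
  then show "monom_dvd u w" unfolding monom_dvd_def ..
qed (auto simp: monom_dvd_def lookup_add)

text \<open>Describes every member of the ideal, not only its monomials. The right-hand side is an
  ideal containing the generators, which gives one inclusion by minimality; for the other, a
  polynomial is built up term by term, each term being a multiple of a generator.\<close>

lemma genideal_monom_poly:
  assumes A: "A \<subseteq> monomials n"
  shows "Idl\<^bsub>poly_ring n\<^esub> (monom_poly ` A) =
    {p :: 'k::field mpoly. \<forall>z\<in>Poly_Mapping.keys p. z \<in> monomials n \<and> (\<exists>w\<in>A. monom_dvd w z)}"
    (is "?I = ?M")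
proof
  let ?R = "poly_ring n :: 'k mpoly ring"
  interpret R: cring ?R by (rule cring_poly_ring)
  have carr: "monom_poly ` A \<subseteq> carrier ?R" using A by auto
  interpret I: ideal ?I ?R by (rule R.genideal_ideal[OF carr])
  have "ideal ?M ?R"
  proof (rule idealI)
    show "ring ?R" ..
    show "subgroup ?M (add_monoid ?R)"
    proof (rule R.add.subgroupI)
      show "?M \<subseteq> carrier ?R" by (auto simp: poly_ring_def)
      have "0 \<in> ?M" by simp
      then show "?M \<noteq> {}" by blast
      fix p q assume p: "p \<in> ?M"
      have "\<ominus>\<^bsub>?R\<^esub> p = - p"
        by (rule R.minus_equality) (use p in \<open>auto simp: poly_ring_def\<close>)
      then show "\<ominus>\<^bsub>?R\<^esub> p \<in> ?M" using p by simp
      assume "q \<in> ?M"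
      then show "p \<oplus>\<^bsub>?R\<^esub> q \<in> ?M"
        using p keys_add[of p q] by (auto simp: poly_ring_def)
    qed
    fix p q :: "'k mpoly"
    assume p: "p \<in> ?M" and q: "q \<in> carrier ?R"
    have "z \<in> monomials n \<and> (\<exists>w\<in>A. monom_dvd w z)" if z: "z \<in> Poly_Mapping.keys (p * q)" for z
    proof -
      obtain a b where "z = a + b" "a \<in> Poly_Mapping.keys p" "b \<in> Poly_Mapping.keys q"
        using z keys_mult[of p q] by blast
      moreover have "monom_dvd a (a + b)" by (auto simp: monom_dvd_def)
      ultimately show ?thesis
        using p q monom_dvd_trans by (fastforce simp: monomials_add_iff poly_ring_def)
    qed
    then show "p \<otimes>\<^bsub>?R\<^esub> q \<in> ?M" by (simp add: poly_ring_def)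
    then show "q \<otimes>\<^bsub>?R\<^esub> p \<in> ?M" by (simp add: poly_ring_def mult.commute)
  qed
  moreover have "monom_poly ` A \<subseteq> ?M"
    using A monom_dvd_refl by (fastforce simp: monom_poly_def)
  ultimately show "?I \<subseteq> ?M" by (rule R.genideal_minimal)
  have "p \<in> ?I" if "p \<in> ?M" for p
    using that
  proof (induction p rule: update_induct)
    case const
    then show ?case using I.zero_closed by (simp add: poly_ring_def)
  next
    case (update p z c)
    have keys: "Poly_Mapping.keys (Poly_Mapping.update z c p) = insert z (Poly_Mapping.keys p)"
      using update(2) by (simp add: keys_update)
    have z: "z \<in> monomials n" "\<exists>w\<in>A. monom_dvd w z" using update.prems keys by auto
    have "monom_poly z \<in> ?I"
      using monom_poly_in_genideal_iff[OF A z(1)] z(2) by blast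
    \<comment> \<open>The exponent vector \<open>0\<close> is the monomial 1, so this is the
      constant polynomial \<open>c\<close>; multiplying by it puts the coefficient on
      \<open>z\<close>.\<close>
    moreover have "Poly_Mapping.single 0 c \<in> carrier ?R"
      by (simp add: poly_ring_def monomials_def)
    ultimately have "monom_poly z \<otimes>\<^bsub>?R\<^esub> Poly_Mapping.single 0 c \<in> ?I" by (rule I.I_r_closed)
    then have "Poly_Mapping.single z c \<in> ?I"
      by (simp add: poly_ring_def monom_poly_def mult_single)
    moreover have "p \<in> ?I" using update keys by simp
    ultimately have "p \<oplus>\<^bsub>?R\<^esub> Poly_Mapping.single z c \<in> ?I" by blast
    moreover have "Poly_Mapping.update z c p = p + Poly_Mapping.single z c"
      using update(1) by (intro poly_mapping_eqI)
        (auto simp: lookup_update lookup_add lookup_single when_def in_keys_iff)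
    ultimately show ?case by (simp add: poly_ring_def)
  qed
  then show "?M \<subseteq> ?I" by blast
qed

text \<open>The shift \<open>z + u\<close> is injective in \<open>z\<close>, so no terms cancel and
  \<open>keys_mult\<close> sharpens to an equality.\<close>

lemma keys_mult_monom_poly:
  "Poly_Mapping.keys (p * monom_poly u) = (\<lambda>z. z + u) ` Poly_Mapping.keys p"
  for p :: "'k::field mpoly"
proof -
  have "Poly_Mapping.lookup (p * monom_poly u) (z + u) = Poly_Mapping.lookup p z" for z
  proof (induction p rule: update_induct)
    case (update p w c)
    have "Poly_Mapping.update w c p = p + Poly_Mapping.single w c"
      using update(1) by (intro poly_mapping_eqI)
        (auto simp: lookup_update lookup_add lookup_single when_def in_keys_iff)
    then show ?case
      using update(3)
      by (simp add: distrib_right lookup_add monom_poly_def mult_single lookup_single when_def)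
  qed simp
  then have "(\<lambda>z. z + u) ` Poly_Mapping.keys p \<subseteq> Poly_Mapping.keys (p * monom_poly u)"
    by (auto simp: in_keys_iff)
  moreover have "Poly_Mapping.keys (p * monom_poly u) \<subseteq> (\<lambda>z. z + u) ` Poly_Mapping.keys p"
    using keys_mult[of p "monom_poly u"] by (auto simp: monom_poly_def)
  ultimately show ?thesis by blast
qed

text \<open>Membership is tested on the generator \<open>monom_poly u\<close> for one inclusion. For
  the other, every monomial of an element of the principal ideal is a multiple of \<open>u\<close>,
  so each monomial of the product is a multiple of some \<open>a + u\<close>.\<close>

lemma colon_ideal_monom_poly:
  assumes A: "A \<subseteq> monomials n" and u: "u \<in> monomials n"
  shows "colon_ideal (poly_ring n) (Idl\<^bsub>poly_ring n\<^esub> (monom_poly ` A)) (Idl\<^bsub>poly_ring n\<^esub> {monom_poly u}) =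
    {p :: 'k::field mpoly. \<forall>z\<in>Poly_Mapping.keys p. z \<in> monomials n \<and> (\<exists>w\<in>A. monom_dvd w (z + u))}"
    (is "?C = ?M")
proof
  let ?R = "poly_ring n :: 'k mpoly ring"
  interpret R: cring ?R by (rule cring_poly_ring)
  have "monom_poly u \<in> Idl\<^bsub>?R\<^esub> {monom_poly u}"
    using u by (intro R.genideal_self') simp
  then have "?C \<subseteq> {p \<in> carrier ?R. p * monom_poly u \<in> Idl\<^bsub>?R\<^esub> (monom_poly ` A)}"
    by (auto simp: colon_ideal_def poly_ring_def)
  also have "\<dots> \<subseteq> ?M"
    unfolding genideal_monom_poly[OF A] by (auto simp: keys_mult_monom_poly poly_ring_def)
  finally show "?C \<subseteq> ?M" .
  have "p \<otimes>\<^bsub>?R\<^esub> q \<in> Idl\<^bsub>?R\<^esub> (monom_poly ` A)"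
    if p: "p \<in> ?M" and q: "q \<in> Idl\<^bsub>?R\<^esub> {monom_poly u}" for p q :: "'k mpoly"
  proof -
    have q': "\<forall>z\<in>Poly_Mapping.keys q. z \<in> monomials n \<and> monom_dvd u z"
      using q genideal_monom_poly[of "{u}" n, where 'k = 'k] u by simp
    have "z \<in> monomials n \<and> (\<exists>w\<in>A. monom_dvd w z)" if z: "z \<in> Poly_Mapping.keys (p * q)" for z
    proof -
      obtain a b where ab: "z = a + b" "a \<in> Poly_Mapping.keys p" "b \<in> Poly_Mapping.keys q"
        using z keys_mult[of p q] by blast
      then obtain w where w: "w \<in> A" "monom_dvd w (a + u)" using p by blast
      have "monom_dvd (a + u) z"
        using q' ab by (auto simp: monom_dvd_def add.assoc)
      with w(2) have "monom_dvd w z" by (rule monom_dvd_trans)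
      then show ?thesis
        using w(1) ab p q' by (auto simp: monomials_add_iff)
    qed
    then show ?thesis
      by (simp add: genideal_monom_poly[OF A]) (simp add: poly_ring_def)
  qed
  then show "?M \<subseteq> ?C"
    by (auto simp: colon_ideal_def) (auto simp: poly_ring_def)
qed

section \<open>Powers of monomial ideals\<close>

text \<open>On exponent vectors these are the \<open>t\<close>-fold products of elements of
  \<open>A\<close>, repetitions allowed. The multiset records a factorization, whose factors can
  then be exchanged.\<close>

definition sum_msets :: "'a::comm_monoid_add set \<Rightarrow> nat \<Rightarrow> 'a set" where
  "sum_msets A t = {\<Sum>\<^sub># M | M. set_mset M \<subseteq> A \<and> size M = t}"

lemma sum_msetsI: "set_mset M \<subseteq> A \<Longrightarrow> size M = t \<Longrightarrow> \<Sum>\<^sub># M \<in> sum_msets A t"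
  by (auto simp: sum_msets_def)

lemma sum_msets_0: "sum_msets A 0 = {0}"
  by (auto simp: sum_msets_def)

text \<open>Splits off one factor, matching the recursion of ideal powers.\<close>

lemma sum_msets_Suc: "sum_msets A (Suc t) = {w + a | w a. w \<in> sum_msets A t \<and> a \<in> A}"
proof (intro equalityI subsetI)
  fix x assume "x \<in> sum_msets A (Suc t)"
  then obtain M where M: "x = \<Sum>\<^sub># M" "set_mset M \<subseteq> A" "size M = Suc t"
    by (auto simp: sum_msets_def)
  then obtain a N where "M = add_mset a N" by (meson size_eq_Suc_imp_eq_union)
  then show "x \<in> {w + a | w a. w \<in> sum_msets A t \<and> a \<in> A}"
    using M unfolding sum_msets_def
    by (intro CollectI exI[of _ "\<Sum>\<^sub># N"] exI[of _ a]) (auto simp: add.commute)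
next
  fix x assume "x \<in> {w + a | w a. w \<in> sum_msets A t \<and> a \<in> A}"
  then obtain M a where M: "x = \<Sum>\<^sub># M + a" "set_mset M \<subseteq> A" "size M = t" "a \<in> A"
    by (auto simp: sum_msets_def)
  then show "x \<in> sum_msets A (Suc t)"
    unfolding sum_msets_def by (intro CollectI exI[of _ "add_mset a M"]) (simp add: add.commute)
qed

lemma sum_msets_monomials:
  assumes "A \<subseteq> monomials n"
  shows "sum_msets A t \<subseteq> monomials n"
proof (induction t)
  case 0
  then show ?case by (simp add: sum_msets_0 monomials_def)
next
  case (Suc t)
  then show ?case using assms by (auto simp: sum_msets_Suc monomials_add_iff)
qed

lemma ideal_prod_monom_poly:
  assumes A: "A \<subseteq> monomials n" and B: "B \<subseteq> monomials n"
  shows "(Idl\<^bsub>poly_ring n\<^esub> (monom_poly ` A)) \<cdot>\<^bsub>poly_ring n\<^esub> (Idl\<^bsub>poly_ring n\<^esub> (monom_poly ` B)) =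
    Idl\<^bsub>poly_ring n\<^esub> (monom_poly ` {a + b | a b. a \<in> A \<and> b \<in> B} :: 'k::field mpoly set)"
    (is "?I \<cdot>\<^bsub>_\<^esub> ?J = Idl\<^bsub>_\<^esub> (monom_poly ` ?AB)")
proof
  let ?R = "poly_ring n :: 'k mpoly ring"
  interpret R: cring ?R by (rule cring_poly_ring)
  have carr: "monom_poly ` A \<subseteq> carrier ?R" "monom_poly ` B \<subseteq> carrier ?R" using A B by auto
  have ideals: "ideal ?I ?R" "ideal ?J ?R" using carr by (auto intro: R.genideal_ideal)
  have AB: "?AB \<subseteq> monomials n" using A B by (fastforce simp: monomials_add_iff)
  have "monom_poly ` ?AB \<subseteq> carrier ?R" using A B by (fastforce simp: monomials_add_iff)
  then have "ideal (Idl\<^bsub>?R\<^esub> (monom_poly ` ?AB)) ?R" by (rule R.genideal_ideal)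
  moreover have "p \<otimes>\<^bsub>?R\<^esub> q \<in> Idl\<^bsub>?R\<^esub> (monom_poly ` ?AB)" if p: "p \<in> ?I" and q: "q \<in> ?J" for p q
  proof -
    have "z \<in> monomials n \<and> (\<exists>w\<in>?AB. monom_dvd w z)" if z: "z \<in> Poly_Mapping.keys (p * q)" for z
    proof -
      obtain c d where cd: "z = c + d" "c \<in> Poly_Mapping.keys p" "d \<in> Poly_Mapping.keys q"
        using z keys_mult[of p q] by blast
      then obtain a b where "a \<in> A" "monom_dvd a c" "b \<in> B" "monom_dvd b d"
        using p q by (fastforce simp: genideal_monom_poly[OF A] genideal_monom_poly[OF B])
      moreover from this have "monom_dvd (a + b) z"
        by (simp add: cd monom_dvd_iff_lookup lookup_add add_mono)
      ultimately show ?thesis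
        using cd p q by (auto simp: genideal_monom_poly[OF A] genideal_monom_poly[OF B] monomials_add_iff)
    qed
    then show ?thesis
      by (simp add: genideal_monom_poly[OF AB]) (simp add: poly_ring_def)
  qed
  ultimately show "?I \<cdot>\<^bsub>?R\<^esub> ?J \<subseteq> Idl\<^bsub>?R\<^esub> (monom_poly ` ?AB)"
    unfolding R.ideal_prod_eq_genideal[OF ideals]
    by (intro R.genideal_minimal) (auto simp: set_mult_def)
  have "monom_poly (a + b) \<in> ?I \<cdot>\<^bsub>?R\<^esub> ?J" if "a \<in> A" "b \<in> B" for a b
  proof -
    have "monom_poly a \<otimes>\<^bsub>?R\<^esub> monom_poly b \<in> ?I \<cdot>\<^bsub>?R\<^esub> ?J"
      using that R.genideal_self[OF carr(1)] R.genideal_self[OF carr(2)]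
      by (intro ideal_prod.prod) blast+
    then show ?thesis by (simp add: poly_ring_def monom_poly_def mult_single)
  qed
  then show "Idl\<^bsub>?R\<^esub> (monom_poly ` ?AB) \<subseteq> ?I \<cdot>\<^bsub>?R\<^esub> ?J"
    by (intro R.genideal_minimal R.ideal_prod_is_ideal ideals) auto
qed

lemma ideal_power_monom_poly:
  assumes A: "A \<subseteq> monomials n"
  shows "(Idl\<^bsub>poly_ring n\<^esub> (monom_poly ` A)) [^]\<^bsub>ideals_set (poly_ring n)\<^esub> t =
    Idl\<^bsub>poly_ring n\<^esub> (monom_poly ` sum_msets A t :: 'k::field mpoly set)"
proof (induction t)
  case 0
  \<comment> \<open>The zeroth power is the whole ring, generated by the empty product, the monomial
    1.\<close>
  have "{0} \<subseteq> monomials n" by (simp add: monomials_def)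
  then have "Idl\<^bsub>poly_ring n\<^esub> (monom_poly ` {0} :: 'k mpoly set) = carrier (poly_ring n)"
    by (subst genideal_monom_poly) (auto simp: poly_ring_def monom_dvd_def)
  then show ?case by (simp add: sum_msets_0 nat_pow_def ideals_set_def)
next
  case (Suc t)
  then show ?case
    using ideal_prod_monom_poly[OF sum_msets_monomials[OF A] A]
    by (simp add: sum_msets_Suc nat_pow_def ideals_set_def)
qed

section \<open>Degrees, and minimal generators of ideals generated in one degree\<close>

lemma monom_degree_add: "monom_degree (u + w) = monom_degree u + monom_degree w"
proof -
  have deg: "monom_degree x = (\<Sum>s\<in>X. Poly_Mapping.lookup x s)"
    if "finite X" "Poly_Mapping.keys x \<subseteq> X" for x X
    unfolding monom_degree_def using that by (intro sum.mono_neutral_left) (auto simp: in_keys_iff)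
  let ?X = "Poly_Mapping.keys u \<union> Poly_Mapping.keys w"
  show ?thesis
    using deg[of ?X u] deg[of ?X w] deg[of ?X "u + w"] keys_add[of u w]
    by (simp add: lookup_add sum.distrib)
qed

lemma monom_degree_eq_0_iff: "monom_degree u = 0 \<longleftrightarrow> u = 0"
  by (auto simp: monom_degree_def in_keys_iff intro: poly_mapping_eqI)

lemma monom_dvd_same_degree:
  assumes "monom_dvd u w" "monom_degree u = monom_degree w"
  shows "u = w"
  using assms by (auto simp: monom_dvd_def monom_degree_add monom_degree_eq_0_iff)

lemma min_mon_gens_equidegree:
  assumes A: "A \<subseteq> monomials n" and deg: "\<And>a. a \<in> A \<Longrightarrow> monom_degree a = d"
  shows "min_mon_gens n (Idl\<^bsub>poly_ring n\<^esub> (monom_poly ` A) :: 'k::field mpoly set) = A"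
proof -
  have mem: "monom_poly w \<in> (Idl\<^bsub>poly_ring n\<^esub> (monom_poly ` A) :: 'k mpoly set) \<longleftrightarrow>
      (\<exists>a\<in>A. monom_dvd a w)" if "w \<in> monomials n" for w
    by (rule monom_poly_in_genideal_iff[OF A that])
  show ?thesis
  proof (intro equalityI subsetI)
    fix u assume "u \<in> min_mon_gens n (Idl\<^bsub>poly_ring n\<^esub> (monom_poly ` A) :: 'k mpoly set)"
    then show "u \<in> A"
      using A mem monom_dvd_refl unfolding min_mon_gens_def by blast
  next
    fix u assume u: "u \<in> A"
    have "w = u" if w: "w \<in> monomials n" "\<exists>a\<in>A. monom_dvd a w" "monom_dvd w u" for w
    proof -
      obtain a where a: "a \<in> A" "monom_dvd a w" using w by blast
      \<comment> \<open>Since \<open>a\<close> divides \<open>w\<close> and \<open>w\<close> divides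
        \<open>u\<close>, equality of degrees forces \<open>a = u\<close>, and \<open>w\<close> is
        squeezed in between.\<close>
      then have "a = u"
        using monom_dvd_trans[OF a(2) w(3)] deg[OF a(1)] deg[OF u] monom_dvd_same_degree by metis
      then have "Poly_Mapping.lookup w s = Poly_Mapping.lookup u s" for s
        using a(2) w(3) by (simp add: monom_dvd_iff_lookup le_antisym)
      then show ?thesis by (rule poly_mapping_eqI)
    qed
    then show "u \<in> min_mon_gens n (Idl\<^bsub>poly_ring n\<^esub> (monom_poly ` A) :: 'k mpoly set)"
      using u A mem monom_dvd_refl unfolding min_mon_gens_def by blast
  qed
qed

section \<open>Products of edges of a lexsegment\<close>

lemma monom_degree_var: "monom_degree (var a) = 1"
  by (simp add: monom_degree_def var_def)

lemma lookup_var: "Poly_Mapping.lookup (var a) s = (if s = a then 1 else 0)"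
  by (simp add: var_def lookup_single when_def)

lemma var_in_monomials_iff: "var a \<in> monomials n \<longleftrightarrow> a \<in> {1..n}"
  by (simp add: var_def monomials_def)

lemma var_dvd_iff: "monom_dvd (var r) z \<longleftrightarrow> 0 < Poly_Mapping.lookup z r"
  unfolding monom_dvd_iff_lookup by (auto simp: lookup_var Suc_le_eq)

lemma lex_initial_monomials: "lex_initial n v \<subseteq> monomials n"
  by (auto simp: lex_initial_def)

text \<open>A squarefree monomial of degree 2 has exactly two variables, so it is an edge; the form
  singles out a prescribed endpoint \<open>s\<close>.\<close>

lemma lex_initial_edgeE:
  assumes "w \<in> lex_initial n v" "0 < Poly_Mapping.lookup w s"
  obtains a where "w = var a + var s" "a \<noteq> s" "a \<in> {1..n}" "s \<in> {1..n}"
proof -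
  from assms have w: "w \<in> monomials n" "squarefree_monom w" "monom_degree w = 2"
    by (auto simp: lex_initial_def)
  have one: "Poly_Mapping.lookup w i = 1" if "i \<in> Poly_Mapping.keys w" for i
    using w(2) that by (simp add: squarefree_monom_def in_keys_iff le_antisym Suc_le_eq)
  then have "card (Poly_Mapping.keys w) = 2" using w(3) by (simp add: monom_degree_def)
  moreover have "s \<in> Poly_Mapping.keys w" using assms(2) by (simp add: in_keys_iff)
  ultimately obtain a where a: "Poly_Mapping.keys w = {a, s}" "a \<noteq> s"
    unfolding card_2_iff by (metis insertE insert_commute singletonD)
  have "w = var a + var s"
  proof (rule poly_mapping_eqI)
    fix i
    have "Poly_Mapping.lookup w i = (if i = a \<or> i = s then 1 else 0)"
      using one[of i] a(1) in_keys_iff[of i w] by simp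
    then show "Poly_Mapping.lookup w i = Poly_Mapping.lookup (var a + var s) i"
      using a(2) by (simp add: lookup_add lookup_var)
  qed
  with a w(1) that show thesis by (auto simp: monomials_def)
qed

text \<open>Lowering an endpoint makes the edge lexicographically larger, and an initial lexsegment
  is closed upwards; \<open>r \<noteq> a\<close> keeps the result squarefree.\<close>

lemma lex_initial_exchange:
  assumes e: "var a + var s \<in> lex_initial n v" and r: "1 \<le> r" "r < s" "r \<noteq> a"
  shows "var a + var r \<in> lex_initial n v"
proof -
  have "var a + var s \<le> var a + var r"
    using r by (intro add_left_mono) (simp add: var_less_var_iff less_imp_le)
  then show ?thesis
    using e r unfolding lex_initial_def squarefree_monom_def
    by (auto simp: monomials_add_iff var_in_monomials_iff monom_degree_add monom_degree_var
        lookup_add lookup_var intro: order_trans)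
qed

lemma lookup_sum_mset:
  "Poly_Mapping.lookup (\<Sum>\<^sub># M) s = (\<Sum>w\<in>#M. Poly_Mapping.lookup w s)"
  by (induction M) (auto simp: lookup_add)

lemma sum_msets_degree:
  assumes "w \<in> sum_msets (lex_initial n v) t"
  shows "monom_degree w = 2 * t"
  using assms
proof (induction t arbitrary: w)
  case 0
  then show ?case by (simp add: sum_msets_0 monom_degree_eq_0_iff)
next
  case (Suc t)
  then show ?case by (auto simp: sum_msets_Suc monom_degree_add lex_initial_def)
qed

text \<open>Each of the \<open>t\<close> edges is squarefree, hence contributes at most one to any
  exponent. This is the origin of the bound \<open>\<le> t\<close> on the exponent of
  \<open>x_r\<close>.\<close>

lemma sum_msets_lookup_le:
  assumes "w \<in> sum_msets (lex_initial n v) t"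
  shows "Poly_Mapping.lookup w s \<le> t"
  using assms
proof (induction t arbitrary: w)
  case 0
  then show ?case by (simp add: sum_msets_0)
next
  case (Suc t)
  then obtain x e where "w = x + e" "x \<in> sum_msets (lex_initial n v) t" "e \<in> lex_initial n v"
    by (auto simp: sum_msets_Suc)
  moreover from this have "Poly_Mapping.lookup e s \<le> 1"
    by (simp add: lex_initial_def squarefree_monom_def)
  ultimately show ?case using Suc.IH[of x] by (simp add: lookup_add)
qed

text \<open>The equation for \<open>w\<close> says \<open>w = x_r u / x_s\<close> without division.
  The new product arises by altering one or two factors of a factorization \<open>M\<close> of
  \<open>u\<close>.\<close>

lemma sum_msets_exchange:
  assumes u: "u \<in> sum_msets (lex_initial n v) t"
    and s: "0 < Poly_Mapping.lookup u s" "\<And>i. 0 < Poly_Mapping.lookup u i \<Longrightarrow> i \<le> s"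
    and r: "1 \<le> r" "r < s" "Poly_Mapping.lookup u r < t"
  obtains w where "w \<in> sum_msets (lex_initial n v) t" "w + var s = var r + u"
proof -
  let ?E = "lex_initial n v"
  obtain M where M: "u = \<Sum>\<^sub># M" "set_mset M \<subseteq> ?E" "size M = t"
    using u by (auto simp: sum_msets_def)
  have lookup_u: "Poly_Mapping.lookup u i = (\<Sum>w\<in>#M. Poly_Mapping.lookup w i)" for i
    by (simp add: M(1) lookup_sum_mset)
  have edge: "e \<in> ?E" if "e \<in># M" for e using M(2) that by blast
  have le_s: "i \<le> s" if "e \<in># M" "0 < Poly_Mapping.lookup e i" for e i
  proof -
    obtain N where "M = add_mset e N" using \<open>e \<in># M\<close> by (metis mset_add)
    with \<open>0 < Poly_Mapping.lookup e i\<close> show ?thesis by (intro s(2)) (simp add: lookup_u)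
  qed
  show thesis
  proof (cases "\<exists>e\<in>#M. 0 < Poly_Mapping.lookup e s \<and> Poly_Mapping.lookup e r = 0")
    case True
    then obtain e where e: "e \<in># M" "0 < Poly_Mapping.lookup e s" "Poly_Mapping.lookup e r = 0"
      by blast
    obtain a where a: "e = var a + var s" by (rule lex_initial_edgeE[OF edge[OF e(1)] e(2)])
    have "r \<noteq> a" using e(3) by (auto simp: a lookup_add lookup_var)
    then have new: "var a + var r \<in> ?E"
      by (rule lex_initial_exchange[OF edge[OF e(1), unfolded a] r(1,2)])
    obtain N where N: "M = add_mset e N" using e(1) by (metis mset_add)
    let ?M = "add_mset (var a + var r) N"
    show thesis
    proof
      show "\<Sum>\<^sub># ?M \<in> sum_msets ?E t" using M N new by (intro sum_msetsI) auto
      show "\<Sum>\<^sub># ?M + var s = var r + u" by (simp add: M(1) N a ac_simps)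
    qed
  next
    case False
    have "\<exists>e\<in>#M. 0 < Poly_Mapping.lookup e s"
    proof (rule ccontr)
      assume "\<not> ?thesis"
      then have "Poly_Mapping.lookup u s = 0"
        unfolding lookup_u by (intro sum_mset.neutral) auto
      then show False using s(1) by simp
    qed
    then obtain e where e: "e \<in># M" "0 < Poly_Mapping.lookup e s" by blast
    obtain a where a: "e = var a + var s" by (rule lex_initial_edgeE[OF edge[OF e(1)] e(2)])
    \<comment> \<open>In this case every edge through \<open>s\<close> also contains
      \<open>r\<close>, so it is the edge \<open>rs\<close>.\<close>
    have "0 < Poly_Mapping.lookup e r" using False e by (meson gr0I)
    then have "a = r" using r(2) by (simp add: a lookup_add lookup_var split: if_splits)
    with a have rs: "e = var r + var s" by simp
    \<comment> \<open>If all \<open>t\<close> edges contained \<open>r\<close>, the exponent of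
      \<open>r\<close> in \<open>u\<close> would be at least \<open>t\<close>.\<close>
    have "\<exists>f\<in>#M. Poly_Mapping.lookup f r = 0"
    proof (rule ccontr)
      assume "\<not> ?thesis"
      then have "(\<Sum>w\<in>#M. 1) \<le> (\<Sum>w\<in>#M. Poly_Mapping.lookup w r)"
        by (intro sum_mset_mono) (auto simp: Suc_le_eq)
      then show False using r(3) by (simp add: lookup_u M(3))
    qed
    then obtain f where f: "f \<in># M" "Poly_Mapping.lookup f r = 0" by blast
    then have f_s: "Poly_Mapping.lookup f s = 0" using False by (meson gr0I)
    have "f \<noteq> 0" using f(1) M(2) by (auto simp: lex_initial_def monom_degree_def)
    then obtain c where "0 < Poly_Mapping.lookup f c"
      by (auto simp: in_keys_iff simp flip: keys_eq_empty)
    then obtain b where bc: "f = var b + var c" "b \<in> {1..n}" "c \<in> {1..n}"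
      by (rule lex_initial_edgeE[OF edge[OF f(1)]])
    then have ne: "b \<noteq> r" "c \<noteq> r" "b \<noteq> s" "c \<noteq> s"
      using f(2) f_s by (auto simp: lookup_add lookup_var split: if_splits)
    \<comment> \<open>Maximality of \<open>s\<close> in \<open>u\<close> enters here:
      \<open>b\<close> and \<open>c\<close> lie strictly below \<open>s\<close>, so
      \<open>rb\<close> and \<open>rc\<close> both arise from \<open>rs\<close> by lowering
      \<open>s\<close>.\<close>
    have "b \<le> s" "c \<le> s"
      using le_s[OF f(1), of b] le_s[OF f(1), of c] bc by (auto simp: lookup_add lookup_var)
    then have edges: "var r + var b \<in> ?E" "var r + var c \<in> ?E"
      using lex_initial_exchange[OF edge[OF e(1), unfolded rs]] ne bc(2,3) by simp_all
    \<comment> \<open>Distinctness allows both edges to be removed from \<open>M\<close> at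
      once.\<close>
    have "e \<noteq> f" using e(2) f_s by auto
    then obtain N where N: "M = add_mset e (add_mset f N)"
      using e(1) f(1) by (metis add_eq_conv_ex mset_add)
    let ?M = "add_mset (var r + var b) (add_mset (var r + var c) N)"
    show thesis
    proof
      show "\<Sum>\<^sub># ?M \<in> sum_msets ?E t" using M N edges by (intro sum_msetsI) auto
      show "\<Sum>\<^sub># ?M + var s = var r + u" by (simp add: M(1) N rs bc ac_simps)
    qed
  qed
qed

section \<open>Lexicographic comparison and the divisibility form of the colon\<close>

lemma lex_greater_same_degree:
  assumes "u < w" "monom_degree w = monom_degree u"
  obtains r where "Poly_Mapping.lookup u r < Poly_Mapping.lookup w r"
    and "r < Max (Poly_Mapping.keys u)"
proof -
  obtain r where r: "Poly_Mapping.lookup u r < Poly_Mapping.lookup w r"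
    "\<And>j. j < r \<Longrightarrow> Poly_Mapping.lookup u j = Poly_Mapping.lookup w j"
    using assms(1) by (auto simp: monom_less_iff_lex)
  \<comment> \<open>Otherwise \<open>u\<close> vanishes beyond the first difference
    \<open>r\<close>, so \<open>u\<close> divides \<open>w\<close>; equal degrees then give
    \<open>u = w\<close>, contradicting \<open>u < w\<close>.\<close>
  have "r < Max (Poly_Mapping.keys u)"
  proof (rule ccontr)
    assume not_less: "\<not> ?thesis"
    have "Poly_Mapping.lookup u j \<le> Poly_Mapping.lookup w j" for j
    proof (cases "j \<le> r")
      case True
      then show ?thesis using r by (cases "j = r") auto
    next
      case False
      then have "j \<notin> Poly_Mapping.keys u"
        using not_less Max_ge[OF finite_keys, of j u] by linarith
      then show ?thesis by (simp add: in_keys_iff)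
    qed
    then have "u = w"
      using assms(2) by (intro monom_dvd_same_degree) (auto simp: monom_dvd_iff_lookup)
    then show False using assms(1) by simp
  qed
  with r(1) show thesis by (rule that)
qed

lemma greater_product_dvd_iff:
  assumes u: "u \<in> sum_msets (lex_initial n v) t" and t: "1 \<le> t"
  shows "(\<exists>w\<in>sum_msets (lex_initial n v) t. u < w \<and> monom_dvd w (z + u)) \<longleftrightarrow>
    (\<exists>r. 1 \<le> r \<and> r \<le> Max (Poly_Mapping.keys u) - 1 \<and> Poly_Mapping.lookup (var r + u) r \<le> t \<and>
      monom_dvd (var r) z)"
    (is "?L \<longleftrightarrow> ?R")
proof
  assume ?L
  then obtain w where w: "w \<in> sum_msets (lex_initial n v) t" "u < w" "monom_dvd w (z + u)" by blast
  then have "monom_degree w = monom_degree u" using sum_msets_degree u by metis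
  with w(2) obtain r where r: "Poly_Mapping.lookup u r < Poly_Mapping.lookup w r"
    "r < Max (Poly_Mapping.keys u)"
    by (rule lex_greater_same_degree)
  have "w \<in> monomials n" using w(1) sum_msets_monomials[OF lex_initial_monomials] by blast
  moreover have "r \<in> Poly_Mapping.keys w" using r(1) by (simp add: in_keys_iff)
  ultimately have "1 \<le> r" by (auto simp: monomials_def)
  moreover have "Poly_Mapping.lookup (var r + u) r \<le> t"
    using r(1) sum_msets_lookup_le[OF w(1), of r] by (simp add: lookup_add lookup_var)
  \<comment> \<open>As \<open>w\<close> exceeds \<open>u\<close> at \<open>r\<close>, the missing
    factor \<open>x_r\<close> must come from \<open>z\<close>.\<close>
  moreover have "Poly_Mapping.lookup w r \<le> Poly_Mapping.lookup z r + Poly_Mapping.lookup u r"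
    using w(3) by (simp add: monom_dvd_iff_lookup lookup_add)
  then have "monom_dvd (var r) z" using r(1) by (simp add: var_dvd_iff)
  ultimately show ?R using r(2) by (intro exI[of _ r]) auto
next
  assume ?R
  then obtain r where r: "1 \<le> r" "r \<le> Max (Poly_Mapping.keys u) - 1"
    "Poly_Mapping.lookup (var r + u) r \<le> t" "monom_dvd (var r) z" by blast
  let ?s = "Max (Poly_Mapping.keys u)"
  \<comment> \<open>The bound \<open>1 \<le> r\<close> excludes the truncated case of the
    subtraction \<open>?s - 1\<close>.\<close>
  have rs: "r < ?s" using r by linarith
  \<comment> \<open>The degree \<open>2 * t\<close> is positive, so \<open>Max\<close> is taken over
    a nonempty set.\<close>
  have "u \<noteq> 0" using sum_msets_degree[OF u] t monom_degree_eq_0_iff[of u] by auto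
  then have "?s \<in> Poly_Mapping.keys u" by (intro Max_in) auto
  then have "0 < Poly_Mapping.lookup u ?s" by (simp add: in_keys_iff)
  moreover have "i \<le> ?s" if "0 < Poly_Mapping.lookup u i" for i
    using that by (intro Max_ge) (auto simp: in_keys_iff)
  moreover have "Poly_Mapping.lookup u r < t" using r(3) by (simp add: lookup_add lookup_var)
  ultimately obtain w where w: "w \<in> sum_msets (lex_initial n v) t" "w + var ?s = var r + u"
    using sum_msets_exchange[OF u _ _ r(1) rs] by metis
  have "u < w"
  proof (rule ccontr)
    assume "\<not> u < w"
    \<comment> \<open>From \<open>w \<le> u\<close> and \<open>x_s < x_r\<close> the product
      \<open>w x_s\<close> would be smaller than \<open>u x_r\<close>, although the two are
      equal.\<close>
    then have "w + var ?s < u + var r"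
      using rs by (intro add_le_less_mono) (auto simp: var_less_var_iff)
    then show False by (simp add: w(2) add.commute)
  qed
  moreover have "monom_dvd w (var r + u)" unfolding w(2)[symmetric] monom_dvd_def by blast
  moreover have "monom_dvd (var r + u) (z + u)"
    using r(4) by (auto simp: monom_dvd_def ac_simps)
  ultimately show ?L using w(1) monom_dvd_trans by blast
qed

theorem proposition2p2:
  fixes n t m :: nat
    and v :: monom
    and u :: "nat \<Rightarrow> monom"
    and S :: "'k::field mpoly ring"
    and I :: "'k mpoly set"
  assumes S: "S = poly_ring n"
    and v: "v \<in> monomials n" "squarefree_monom v" "monom_degree v = 2"
    and I: "I = Idl\<^bsub>S\<^esub> (monom_poly ` lex_initial n v)"
    and t: "t \<ge> 1"
    and u_gens: "min_mon_gens n (I [^]\<^bsub>ideals_set S\<^esub> t) = u ` {1..m}"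
    and u_desc: "\<And>i j. 1 \<le> i \<Longrightarrow> i < j \<Longrightarrow> j \<le> m \<Longrightarrow> u i > u j"
  shows "\<forall>i\<in>{2..m}.
    colon_ideal S (Idl\<^bsub>S\<^esub> ((\<lambda>j. monom_poly (u j)) ` {1..i - 1})) (Idl\<^bsub>S\<^esub> {monom_poly (u i)})
      = Idl\<^bsub>S\<^esub> {monom_poly (var r) | r. 1 \<le> r \<and> r \<le> Max (Poly_Mapping.keys (u i)) - 1 \<and>
                             Poly_Mapping.lookup (var r + u i) r \<le> t}"
proof
  fix i assume i: "i \<in> {2..m}"
  let ?P = "sum_msets (lex_initial n v) t"
  let ?C = "\<lambda>r. 1 \<le> r \<and> r \<le> Max (Poly_Mapping.keys (u i)) - 1 \<and>
    Poly_Mapping.lookup (var r + u i) r \<le> t"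
  have P_mon: "?P \<subseteq> monomials n" by (rule sum_msets_monomials[OF lex_initial_monomials])
  \<comment> \<open>All \<open>t\<close>-fold products of edges have degree \<open>2 * t\<close>, so
    each one is a minimal generator of the power.\<close>
  have "min_mon_gens n (Idl\<^bsub>S\<^esub> (monom_poly ` ?P)) = ?P"
    unfolding S using P_mon sum_msets_degree by (rule min_mon_gens_equidegree)
  then have P: "?P = u ` {1..m}"
    using u_gens by (simp add: I S ideal_power_monom_poly[OF lex_initial_monomials])
  then have ui: "u i \<in> ?P" using i by auto
  \<comment> \<open>The enumeration is strictly decreasing, so the generators listed before
    \<open>u i\<close> are exactly the larger ones.\<close>
  have earlier: "u ` {1..i - 1} = {w \<in> ?P. u i < w}"
  proof (intro equalityI subsetI)
    fix w assume "w \<in> {w \<in> ?P. u i < w}"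
    then obtain j where j: "j \<in> {1..m}" "w = u j" "u i < u j" using P by auto
    have "j < i"
    proof (rule ccontr)
      assume "\<not> j < i"
      then have "u j \<le> u i" using u_desc[of i j] i j(1) by (cases "i = j") auto
      then show False using j(3) by simp
    qed
    then show "w \<in> u ` {1..i - 1}" using j by auto
  next
    fix w assume "w \<in> u ` {1..i - 1}"
    then show "w \<in> {w \<in> ?P. u i < w}" unfolding P using u_desc i by auto
  qed
  have "r \<in> {1..n}" if "?C r" for r
  proof -
    have "u i \<noteq> 0" using sum_msets_degree[OF ui] t monom_degree_eq_0_iff[of "u i"] by auto
    then have "Max (Poly_Mapping.keys (u i)) \<in> Poly_Mapping.keys (u i)" by (intro Max_in) auto
    then have "Max (Poly_Mapping.keys (u i)) \<le> n" using ui P_mon by (fastforce simp: monomials_def)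
    then show ?thesis using that by auto
  qed
  then have vars: "var ` {r. ?C r} \<subseteq> monomials n" by (auto simp: var_in_monomials_iff)
  have earlier_mon: "{w \<in> ?P. u i < w} \<subseteq> monomials n" using P_mon by blast
  have eq: "(\<exists>w\<in>{w \<in> ?P. u i < w}. monom_dvd w (z + u i)) \<longleftrightarrow> (\<exists>w\<in>var ` {r. ?C r}. monom_dvd w z)" for z
    using greater_product_dvd_iff[OF ui t, of z] by blast
  \<comment> \<open>Both ideals consist of the polynomials all of whose monomials satisfy a
    divisibility condition, and \<open>eq\<close> identifies the two conditions.\<close>
  have "colon_ideal S (Idl\<^bsub>S\<^esub> (monom_poly ` {w \<in> ?P. u i < w})) (Idl\<^bsub>S\<^esub> {monom_poly (u i)}) =
      Idl\<^bsub>S\<^esub> (monom_poly ` var ` {r. ?C r})"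
    unfolding S genideal_monom_poly[OF vars]
      colon_ideal_monom_poly[OF earlier_mon subsetD[OF P_mon ui]] eq ..
  moreover have "(\<lambda>j. monom_poly (u j) :: 'k mpoly) ` {1..i - 1} = monom_poly ` {w \<in> ?P. u i < w}"
    unfolding earlier[symmetric] by (simp add: image_image)
  moreover have "({monom_poly (var r) | r. ?C r} :: 'k mpoly set) = monom_poly ` var ` {r. ?C r}" by blast
  ultimately show "colon_ideal S (Idl\<^bsub>S\<^esub> ((\<lambda>j. monom_poly (u j)) ` {1..i - 1})) (Idl\<^bsub>S\<^esub> {monom_poly (u i)})
      = Idl\<^bsub>S\<^esub> {monom_poly (var r) | r. ?C r}"
    by (simp only:)
qed

end
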